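(* Let $n\ge 2$ be an integer with prime factorization $n=p_1^{\alpha_1}\cdots p_k^{\alpha_k}$, where $p_1<p_2<\cdots<p_k$ are primes and $\alpha_i\ge 1$. Let $D_n$ be the set of divisors $d$ of $n$ with $1\le d<n$, and let $\overline{D}_{p_1}=\{d\in D_n : p_1\nmid d\}$. Let $D\subseteq D_n$ be arbitrary and let $\mathrm{ICG}_n(D)$ be the corresponding integral circulant graph, with eigenvalues $\lambda_j(n,D)$. Then for every $1\le j\le n-1$, $$\lambda_j(n,D)\ \ge\ -\frac{n}{p_1},$$ with equality if and only if $D=\overline{D}_{p_1}$ and $\frac{n}{p_1}\mid j$.
   Context: For $D\subseteq D_n$, the integral circulant graph $\mathrm{ICG}_n(D)$ has vertex set $\mathbb{Z}_n=\{0,1,\ldots,n-1\}$, with $a$ and $b$ adjacent if and only if $\gcd(a-b,n)\in D$. The eigenvalues of its adjacency matrix are indexed as $$\lambda_j(n,D)=\sum_{d\in D} c\left(j,\tfrac{n}{d}\right),\qquad 0\le j\le n-1,$$ where the Ramanujan function is, for a positive integer $m$ and an integer $j\geq 0$, $$c(j,m)=\mu(t_{m,j})\frac{\varphi(m)}{\varphi(t_{m,j})},\qquad t_{m,j}=\frac{m}{\gcd(m,j)},$$ with $\mu$ the Möbius function, $\varphi$ Euler's totient function, and $\gcd(m,0)=m$. (Equivalently, $c(j,m)$ is the sum of $e^{2\pi i js/m}$ over $1\le s\le m$ with $\gcd(s,m)=1$.) *)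

theory Defs
  imports
    "HOL-Computational_Algebra.Squarefree"
    "HOL-Number_Theory.Number_Theory"
    "Jordan_Normal_Form.Char_Poly"
begin

definition moebius :: "nat \<Rightarrow> int" where
  "moebius m = (if squarefree m then (- 1) ^ card (prime_factors m) else 0)"

text \<open>
  The quotient of the two totients is always an integer, because \<open>m div gcd m j\<close> divides
  \<open>m\<close>; real division is used only so that no truncation has to be argued about.
  For \<open>j = 0\<close> the library's convention gives \<open>gcd m 0 = m\<close>, as required.
\<close>

definition ramanujan :: "nat \<Rightarrow> nat \<Rightarrow> real" where
  "ramanujan j m =
     (let t = m div gcd m j
      in of_int (moebius t) * (real (totient m) / real (totient t)))"

definition proper_divisors :: "nat \<Rightarrow> nat set" where
  "proper_divisors n = {d. d dvd n \<and> 1 \<le> d \<and> d < n}"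

definition icg_adjacent :: "nat \<Rightarrow> nat set \<Rightarrow> nat \<Rightarrow> nat \<Rightarrow> bool" where
  "icg_adjacent n D a b \<longleftrightarrow> a < n \<and> b < n \<and> gcd (nat \<bar>int a - int b\<bar>) n \<in> D"

definition icg_adj_matrix :: "nat \<Rightarrow> nat set \<Rightarrow> complex mat" where
  "icg_adj_matrix n D = mat n n (\<lambda>(a, b). if icg_adjacent n D a b then 1 else 0)"

definition icg_eigenvalue :: "nat \<Rightarrow> nat set \<Rightarrow> nat \<Rightarrow> real" where
  "icg_eigenvalue n D j = (\<Sum>d\<in>D. ramanujan j (n div d))"

text \<open>
  The rest of this theory checks that the numbers \<open>icg_eigenvalue n D j\<close> for \<open>j < n\<close> are
  indeed the eigenvalues of \<open>icg_adj_matrix n D\<close>, with multiplicity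
  (theorem \<open>char_poly_icg_adj_matrix\<close>), and that \<open>ramanujan j m\<close> is the usual sum of powers of
  primitive roots of unity (theorem \<open>ramanujan_sum\<close>).
\<close>

definition zeta :: "nat \<Rightarrow> int \<Rightarrow> complex" where
  "zeta n k = cis (2 * pi * (of_int k / real n))"

lemma zeta_0 [simp]: "zeta n 0 = 1"
  by (simp add: zeta_def)

lemma zeta_add: "zeta n (k + l) = zeta n k * zeta n l"
  by (simp add: zeta_def cis_mult add_divide_distrib distrib_left)

lemma zeta_power: "zeta n (k * int i) = zeta n k ^ i"
  by (simp add: zeta_def DeMoivre mult_ac)

lemma zeta_scale: "d > 0 \<Longrightarrow> zeta (n * d) (k * int d) = zeta n k"
  by (simp add: zeta_def)

lemma zeta_multiple: "n > 0 \<Longrightarrow> zeta n (int n * k) = 1"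
  by (simp add: zeta_def)

lemma zeta_eq_1_iff:
  assumes "n > 0"
  shows "zeta n k = 1 \<longleftrightarrow> int n dvd k"
proof
  assume "zeta n k = 1"
  then have "cos (2 * pi * (of_int k / real n)) = 1"
    by (simp add: zeta_def complex_eq_iff)
  then obtain i :: int where "2 * pi * (of_int k / real n) = of_int i * 2 * pi"
    by (auto simp: cos_one_2pi_int)
  then have "(of_int k :: real) = of_int (i * int n)"
    using assms by (simp add: field_simps)
  then have "k = i * int n"
    unfolding of_int_eq_iff .
  then show "int n dvd k" by simp
next
  assume "int n dvd k"
  then show "zeta n k = 1"
    using zeta_multiple[OF assms] by (auto elim: dvdE)
qed

lemma sum_zeta:
  assumes "n > 0"
  shows "(\<Sum>k<n. zeta n (j * int k)) = (if int n dvd j then of_nat n else 0)"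
proof (cases "int n dvd j")
  case True
  then have "zeta n j = 1" using assms zeta_eq_1_iff by blast
  then show ?thesis using True by (simp add: zeta_power)
next
  case False
  then have "zeta n j \<noteq> 1" using assms zeta_eq_1_iff by blast
  moreover have "zeta n j ^ n = 1"
    using zeta_multiple[OF assms, of j] by (simp add: zeta_power[symmetric] mult.commute)
  ultimately show ?thesis using False by (simp add: zeta_power geometric_sum)
qed

lemma sum_zeta_shifted:
  assumes "n > 0"
  shows "(\<Sum>k\<in>{0<..n}. zeta n (j * int k)) = (if int n dvd j then of_nat n else 0)"
proof -
  have "zeta n (j * int n) = 1"
    using zeta_multiple[OF assms, of j] by (simp add: mult.commute)
  moreover have "{0<..n} = insert n {0<..<n}" "{..<n} = insert 0 {0<..<n}"
    using assms by auto
  ultimately show ?thesis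
    using sum_zeta[OF assms, of j] by simp
qed

lemma moebius_1 [simp]: "moebius (Suc 0) = 1"
  by (simp add: moebius_def)

lemma moebius_prime: "prime p \<Longrightarrow> moebius p = - 1"
  by (simp add: moebius_def squarefree_prime prime_prime_factors)

lemma moebius_prime_power:
  assumes "prime p" "a \<ge> 2"
  shows "moebius (p ^ a) = 0"
proof -
  have "p ^ 2 dvd p ^ a" using assms by (intro le_imp_power_dvd) auto
  moreover have "\<not> p dvd 1" using assms by auto
  ultimately have "\<not> squarefree (p ^ a)"
    unfolding squarefree_def by blast
  then show ?thesis by (simp add: moebius_def)
qed

lemma moebius_mult_coprime:
  assumes "coprime a b" "a > 0" "b > 0"
  shows "moebius (a * b) = moebius a * moebius b"
proof -
  have "prime_factors (a * b) = prime_factors a \<union> prime_factors b"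
    using assms by (intro prime_factors_product) auto
  moreover have "prime_factors a \<inter> prime_factors b = {}"
  proof (rule equals0I)
    fix q assume "q \<in> prime_factors a \<inter> prime_factors b"
    then have "prime q" "q dvd a" "q dvd b" by auto
    then show False
      using assms(1) coprime_common_divisor_nat[of a b q] by auto
  qed
  ultimately have "card (prime_factors (a * b)) = card (prime_factors a) + card (prime_factors b)"
    by (simp add: card_Un_disjoint)
  moreover have "squarefree (a * b) \<longleftrightarrow> squarefree a \<and> squarefree b"
    using squarefree_mult_coprime[OF assms(1)] squarefree_multD[of a b] by blast
  ultimately show ?thesis by (simp add: moebius_def power_add)
qed

lemma ramanujan_mult_coprime:
  assumes "coprime a b" "a > 0" "b > 0"
  shows "ramanujan j (a * b) = ramanujan j a * ramanujan j b"
proof -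
  have g: "gcd (a * b) j = gcd a j * gcd b j"
  proof (rule dvd_antisym)
    obtain x y where xy: "gcd (a * b) j = x * y" "x dvd a" "y dvd b"
      using dvd_productE[of "gcd (a * b) j" a b] gcd_dvd1 by blast
    then have "x dvd j" "y dvd j"
      using gcd_dvd2[of "a * b" j] by (auto dest: dvd_mult_left dvd_mult_right)
    then show "gcd (a * b) j dvd gcd a j * gcd b j"
      using xy by (simp add: mult_dvd_mono)
    have "coprime (gcd a j) (gcd b j)"
      using assms(1) by (rule coprime_divisors[OF gcd_dvd1 gcd_dvd1])
    then have "gcd a j * gcd b j dvd j" by (intro divides_mult) auto
    then show "gcd a j * gcd b j dvd gcd (a * b) j"
      by (simp add: mult_dvd_mono)
  qed
  define s t where "s = a div gcd a j" and "t = b div gcd b j"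
  have st: "a = s * gcd a j" "b = t * gcd b j" by (simp_all add: s_def t_def)
  have pos: "s > 0" "t > 0"
    using assms by (simp_all add: s_def t_def div_greater_zero_iff)
  have cop: "coprime s t"
  proof (rule coprime_divisors[OF _ _ assms(1)])
    show "s dvd a" by (subst st(1)) (rule dvd_triv_left)
    show "t dvd b" by (subst st(2)) (rule dvd_triv_left)
  qed
  have "(a * b) div gcd (a * b) j = s * t"
    unfolding g s_def t_def by (simp add: div_mult_div_if_dvd)
  then show ?thesis
    using cop pos assms
    by (simp add: ramanujan_def Let_def moebius_mult_coprime totient_mult_coprime
        flip: s_def t_def)
qed

lemma sum_ramanujan_prime_power:
  assumes p: "prime p"
  shows "(\<Sum>i\<le>a. ramanujan j (p ^ i)) = (if p ^ a dvd j then real (p ^ a) else 0)"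
proof (induction a)
  case 0
  then show ?case by (simp add: ramanujan_def)
next
  case (Suc a)
  have p1: "p > 1" using p prime_gt_1_nat by blast
  have tot: "real (totient (p ^ Suc a)) = real (p ^ Suc a) - real (p ^ a)"
    using p1 by (simp only: totient_prime_power_Suc[OF p])
      (simp add: of_nat_diff algebra_simps)
  obtain i where i: "i \<le> Suc a" "gcd (p ^ Suc a) j = p ^ i"
    using p by (metis divides_primepow_nat gcd_dvd1)
  have t: "p ^ Suc a div p ^ i = p ^ (Suc a - i)"
    using p1 i(1) by (simp add: power_diff)
  have dvd: "p ^ b dvd j \<longleftrightarrow> b \<le> i" if "b \<le> Suc a" for b
  proof -
    have "p ^ b dvd j \<longleftrightarrow> p ^ b dvd gcd (p ^ Suc a) j"
      using that by (simp add: le_imp_power_dvd del: power_Suc)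
    then show ?thesis unfolding i(2) using p1 by (simp add: dvd_power_iff_le)
  qed
  have R: "ramanujan j (p ^ Suc a) =
      of_int (moebius (p ^ (Suc a - i))) * (real (totient (p ^ Suc a)) / real (totient (p ^ (Suc a - i))))"
    unfolding ramanujan_def i(2) t Let_def by simp
  consider "i = Suc a" | "i = a" | "i < a" using i(1) by linarith
  then show ?case
  proof cases
    case 1
    have "ramanujan j (p ^ Suc a) = real (p ^ Suc a) - real (p ^ a)"
      unfolding R tot using 1 by simp
    then show ?thesis using Suc.IH dvd[of a] dvd[of "Suc a"] 1 by simp
  next
    case 2
    have "real (totient p) = real p - 1"
      using p p1 by (simp add: totient_prime of_nat_diff)
    moreover have "real (p ^ Suc a) - real (p ^ a) = real (p ^ a) * (real p - 1)"
      by (simp add: algebra_simps)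
    ultimately have "ramanujan j (p ^ Suc a) = - real (p ^ a)"
      unfolding R tot using 2 p1 p by (simp add: moebius_prime)
    then show ?thesis using Suc.IH dvd[of a] dvd[of "Suc a"] 2 by simp
  next
    case 3
    then have "ramanujan j (p ^ Suc a) = 0"
      unfolding R using p by (simp add: moebius_prime_power del: power_Suc)
    then show ?thesis using Suc.IH dvd[of a] dvd[of "Suc a"] 3 by simp
  qed
qed

lemma divisors_prime_power_mult:
  fixes p m :: nat
  assumes p: "prime p" and np: "\<not> p dvd m" and m: "m > 0"
  shows "bij_betw (\<lambda>(i, d). p ^ i * d) ({..a} \<times> {d. d dvd m}) {d. d dvd p ^ a * m}"
proof (rule bij_betwI')
  fix x y :: "nat \<times> nat"
  assume x: "x \<in> {..a} \<times> {d. d dvd m}" and y: "y \<in> {..a} \<times> {d. d dvd m}"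
  have mult: "multiplicity p (p ^ i * d) = i" if "d dvd m" for i d
  proof -
    have "\<not> p dvd d" using that np dvd_trans by blast
    moreover have "d \<noteq> 0" using that m by auto
    ultimately show ?thesis
      using p by (simp add: prime_elem_multiplicity_mult_distrib not_dvd_imp_multiplicity_0
          prime_gt_0_nat)
  qed
  show "((case x of (i, d) \<Rightarrow> p ^ i * d) = (case y of (i, d) \<Rightarrow> p ^ i * d)) = (x = y)"
  proof
    assume eq: "(case x of (i, d) \<Rightarrow> p ^ i * d) = (case y of (i, d) \<Rightarrow> p ^ i * d)"
    obtain i d k e where xy: "x = (i, d)" "y = (k, e)" by (cases x; cases y) auto
    have "i = k" using eq xy x y mult[of d i] mult[of e k] by auto
    then show "x = y" using eq xy p by (auto simp: prime_gt_0_nat)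
  qed simp
next
  fix x :: "nat \<times> nat"
  assume "x \<in> {..a} \<times> {d. d dvd m}"
  then show "(case x of (i, d) \<Rightarrow> p ^ i * d) \<in> {d. d dvd p ^ a * m}"
    by (auto intro!: mult_dvd_mono le_imp_power_dvd)
next
  fix e assume "e \<in> {d. d dvd p ^ a * m}"
  then obtain b c where bc: "e = b * c" "b dvd p ^ a" "c dvd m"
    by (auto elim: division_decomp[THEN exE])
  then obtain i where "i \<le> a" "b = p ^ i"
    using p divides_primepow_nat by blast
  then show "\<exists>x\<in>{..a} \<times> {d. d dvd m}. e = (case x of (i, d) \<Rightarrow> p ^ i * d)"
    using bc by (intro bexI[of _ "(i, c)"]) auto
qed

lemma sum_ramanujan_divisors:
  "m > 0 \<Longrightarrow> (\<Sum>d | d dvd m. ramanujan j d) = (if m dvd j then real m else 0)"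
proof (induction m rule: less_induct)
  case (less m)
  show ?case
  proof (cases "m = 1")
    case True
    then show ?thesis by (simp add: ramanujan_def)
  next
    case False
    then obtain p where p: "prime p" "p dvd m" using prime_factor_nat by blast
    define a where "a = multiplicity p m"
    obtain k where k: "m = p ^ a * k" "\<not> p dvd k"
      unfolding a_def using less.prems p(1)
      by (metis multiplicity_decompose' not_prime_unit not_gr_zero)
    have a: "a > 0" using k p(2) by (cases a) auto
    have k0: "k > 0" using k less.prems by (cases k) auto
    have "p ^ a > 1" using p(1) a by (intro one_less_power prime_gt_1_nat)
    then have km: "k < m" using k k0 by simp
    have cop: "coprime (p ^ i) d" if "d dvd k" for i d
      using p(1) k(2) that by (metis coprime_power_left_iff dvd_trans prime_imp_coprime)
    have "(\<Sum>d | d dvd m. ramanujan j d)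
        = (\<Sum>(i, d)\<in>{..a} \<times> {d. d dvd k}. ramanujan j (p ^ i * d))"
      unfolding k(1)
      by (subst sum.reindex_bij_betw[OF divisors_prime_power_mult[OF p(1) k(2) k0], symmetric])
        (simp add: case_prod_unfold)
    also have "\<dots> = (\<Sum>(i, d)\<in>{..a} \<times> {d. d dvd k}. ramanujan j (p ^ i) * ramanujan j d)"
    proof (intro sum.cong refl, clarify)
      fix i d assume "d dvd k"
      then show "ramanujan j (p ^ i * d) = ramanujan j (p ^ i) * ramanujan j d"
        using cop k0 p(1) by (intro ramanujan_mult_coprime) (auto simp: prime_gt_0_nat dvd_pos_nat)
    qed
    also have "\<dots> = (\<Sum>i\<le>a. ramanujan j (p ^ i)) * (\<Sum>d | d dvd k. ramanujan j d)"
      by (simp add: sum_product sum.cartesian_product)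
    also have "\<dots> = (if p ^ a dvd j then real (p ^ a) else 0) * (if k dvd j then real k else 0)"
      by (simp add: sum_ramanujan_prime_power[OF p(1)] less.IH[OF km k0])
    also have "\<dots> = (if m dvd j then real m else 0)"
    proof -
      have "m dvd j \<longleftrightarrow> p ^ a dvd j \<and> k dvd j"
        unfolding k(1) using cop[of k a] by (auto intro: divides_mult dvd_mult_left dvd_mult_right)
      then show ?thesis by (auto simp: k(1))
    qed
    finally show ?thesis .
  qed
qed

lemma sum_zeta_gcd_eq:
  assumes "d dvd m" "m > 0"
  shows "(\<Sum>k | k \<in> {0<..m} \<and> gcd k m = d. zeta m (int j * int k))
       = (\<Sum>s\<in>totatives (m div d). zeta (m div d) (int j * int s))"
proof -
  have d: "d > 0" using assms dvd_pos_nat by blast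
  have "(\<Sum>k | k \<in> {0<..m} \<and> gcd k m = d. zeta m (int j * int k))
      = (\<Sum>s\<in>totatives (m div d). zeta m (int j * int (s * d)))"
    using sum.reindex_bij_betw[OF bij_betw_totatives_gcd_eq[OF assms],
        of "\<lambda>k. zeta m (int j * int k)"] by simp
  also have "\<dots> = (\<Sum>s\<in>totatives (m div d). zeta (m div d) (int j * int s))"
  proof (intro sum.cong refl)
    fix s
    show "zeta m (int j * int (s * d)) = zeta (m div d) (int j * int s)"
      using zeta_scale[OF d, of "m div d" "int j * int s"] assms by (simp add: mult.assoc)
  qed
  finally show ?thesis .
qed

lemma sum_divisors_zeta:
  assumes "m > 0"
  shows "(\<Sum>d | d dvd m. \<Sum>s\<in>totatives d. zeta d (int j * int s))
       = (if m dvd j then of_nat m else 0)"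
proof -
  have fin: "finite {d. d dvd m}" using assms by simp
  have flip: "(\<Sum>d | d dvd m. f d) = (\<Sum>d | d dvd m. f (m div d))" for f :: "nat \<Rightarrow> complex"
    using assms by (intro sum.reindex_bij_witness[of _ "(div) m" "(div) m"]) (auto elim: dvdE)
  have "(\<Sum>d | d dvd m. \<Sum>s\<in>totatives d. zeta d (int j * int s))
      = (\<Sum>d | d dvd m. \<Sum>s\<in>totatives (m div d). zeta (m div d) (int j * int s))"
    by (rule flip)
  also have "\<dots> = (\<Sum>d | d dvd m. \<Sum>k | k \<in> {0<..m} \<and> gcd k m = d. zeta m (int j * int k))"
    using assms sum_zeta_gcd_eq[of _ m j] by (intro sum.cong[OF refl]) simp
  also have "\<dots> = (\<Sum>k\<in>{0<..m}. zeta m (int j * int k))"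
    using fin by (intro sum.group) auto
  finally show ?thesis
    using sum_zeta_shifted[OF assms, of "int j"] by simp
qed

theorem ramanujan_sum:
  "m > 0 \<Longrightarrow> (\<Sum>s\<in>totatives m. zeta m (int j * int s)) = of_real (ramanujan j m)"
proof (induction m rule: less_induct)
  case (less m)
  have split: "(\<Sum>d | d dvd m. f d) = f m + (\<Sum>d | d dvd m \<and> d \<noteq> m. f d)"
    for f :: "nat \<Rightarrow> complex"
  proof -
    have "{d. d dvd m} - {m} = {d. d dvd m \<and> d \<noteq> m}" by auto
    then show ?thesis
      using less.prems sum.remove[of "{d. d dvd m}" m f] by simp
  qed
  have "(\<Sum>d | d dvd m. \<Sum>s\<in>totatives d. zeta d (int j * int s))
      = (\<Sum>d | d dvd m. of_real (ramanujan j d))"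
    using less.prems
    by (simp only: sum_divisors_zeta sum_ramanujan_divisors of_real_sum[symmetric]) simp
  moreover have "(\<Sum>d | d dvd m \<and> d \<noteq> m. \<Sum>s\<in>totatives d. zeta d (int j * int s))
      = (\<Sum>d | d dvd m \<and> d \<noteq> m. of_real (ramanujan j d))"
  proof (intro sum.cong refl)
    fix d assume "d \<in> {d. d dvd m \<and> d \<noteq> m}"
    then have "d < m" "d > 0"
      using less.prems dvd_imp_le[of d m] dvd_pos_nat[of m d] by auto
    then show "(\<Sum>s\<in>totatives d. zeta d (int j * int s)) = of_real (ramanujan j d)"
      by (rule less.IH)
  qed
  ultimately show ?case
    by (simp only: split add_right_cancel)
qed

lemma sum_icg_adj_matrix:
  assumes "D \<subseteq> proper_divisors n" "a < n"
  shows "(\<Sum>b<n. (if icg_adjacent n D a b then 1 else 0) * zeta n (- (int j * int b)))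
       = of_real (icg_eigenvalue n D j) * zeta n (- (int j * int a))"
proof -
  have n: "n > 0" using assms by simp
  have D: "d dvd n" "n div d > 0" if "d \<in> D" for d
    using assms that by (auto simp: proper_divisors_def div_greater_zero_iff)
  have finD: "finite D"
    using assms by (auto intro: finite_subset[of _ "{..<n}"] simp: proper_divisors_def)
  define \<kappa> where "\<kappa> = (\<lambda>b. if b < a then a - b else a + n - b)"
  have gcd_\<kappa>: "gcd (nat \<bar>int a - int b\<bar>) n = gcd (\<kappa> b) n" if "b < n" for b
  proof (cases "b < a")
    case True
    then have "nat \<bar>int a - int b\<bar> = a - b" by linarith
    then show ?thesis using True by (simp only: \<kappa>_def if_True)
  next
    case False
    have "gcd (b - a) n = gcd (n - (b - a)) n"
      using that by (intro gcd_diff2_nat[symmetric]) simp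
    moreover have "n - (b - a) = a + n - b" "nat \<bar>int a - int b\<bar> = b - a"
      using False that by auto
    ultimately show ?thesis using False by (simp add: \<kappa>_def)
  qed
  have zeta_\<kappa>: "zeta n (- (int j * int b)) = zeta n (- (int j * int a)) * zeta n (int j * int (\<kappa> b))"
    if "b < n" for b
  proof (cases "b < a")
    case True
    then have "- (int j * int b) = - (int j * int a) + int j * int (\<kappa> b)"
      by (simp add: \<kappa>_def of_nat_diff algebra_simps)
    then show ?thesis by (simp only: zeta_add)
  next
    case False
    have "- (int j * int a) + int j * int (\<kappa> b) = - (int j * int b) + int n * int j"
      using False that by (simp add: \<kappa>_def of_nat_diff algebra_simps)
    then have "zeta n (- (int j * int a)) * zeta n (int j * int (\<kappa> b))
        = zeta n (- (int j * int b) + int n * int j)"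
      by (simp only: zeta_add[symmetric])
    also have "\<dots> = zeta n (- (int j * int b))"
      by (simp only: zeta_add zeta_multiple[OF n] mult_1_right)
    finally show ?thesis by (rule sym)
  qed
  have "(\<Sum>b<n. (if icg_adjacent n D a b then 1 else 0) * zeta n (- (int j * int b)))
      = (\<Sum>b<n. zeta n (- (int j * int a)) *
          (if gcd (\<kappa> b) n \<in> D then zeta n (int j * int (\<kappa> b)) else 0))"
  proof (rule sum.cong[OF refl])
    fix b assume "b \<in> {..<n}"
    then have b: "b < n" by simp
    have "icg_adjacent n D a b \<longleftrightarrow> gcd (\<kappa> b) n \<in> D"
      using assms(2) b by (simp only: icg_adjacent_def gcd_\<kappa> simp_thms)
    then show "(if icg_adjacent n D a b then 1 else 0) * zeta n (- (int j * int b))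
        = zeta n (- (int j * int a)) *
          (if gcd (\<kappa> b) n \<in> D then zeta n (int j * int (\<kappa> b)) else 0)"
      by (subst zeta_\<kappa>[OF b]) simp
  qed
  also have "\<dots> = zeta n (- (int j * int a)) *
      (\<Sum>b<n. if gcd (\<kappa> b) n \<in> D then zeta n (int j * int (\<kappa> b)) else 0)"
    by (simp add: sum_distrib_left)
  also have "(\<Sum>b<n. if gcd (\<kappa> b) n \<in> D then zeta n (int j * int (\<kappa> b)) else 0)
      = (\<Sum>k\<in>{0<..n}. if gcd k n \<in> D then zeta n (int j * int k) else 0)"
    using assms(2)
    by (intro sum.reindex_bij_witness[of _ "\<lambda>k. if k \<le> a then a - k else a + n - k" \<kappa>])
      (auto simp: \<kappa>_def)
  also have "\<dots> = (\<Sum>k | k \<in> {0<..n} \<and> gcd k n \<in> D. zeta n (int j * int k))"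
    by (rule sum.inter_filter[symmetric]) simp
  also have "\<dots> = (\<Sum>d\<in>D. \<Sum>k | k \<in> {k\<in>{0<..n}. gcd k n \<in> D} \<and> gcd k n = d. zeta n (int j * int k))"
    by (rule sum.group[symmetric]) (use finD in auto)
  also have "\<dots> = (\<Sum>d\<in>D. \<Sum>k | k \<in> {0<..n} \<and> gcd k n = d. zeta n (int j * int k))"
    by (intro sum.cong refl) auto
  also have "\<dots> = (\<Sum>d\<in>D. of_real (ramanujan j (n div d)))"
  proof (rule sum.cong[OF refl])
    fix d assume "d \<in> D"
    then show "(\<Sum>k | k \<in> {0<..n} \<and> gcd k n = d. zeta n (int j * int k))
        = of_real (ramanujan j (n div d))"
      by (simp only: sum_zeta_gcd_eq[OF D(1) n] ramanujan_sum[OF D(2)])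
  qed
  also have "\<dots> = of_real (icg_eigenvalue n D j)"
    by (simp add: icg_eigenvalue_def)
  finally show ?thesis by simp
qed

theorem char_poly_icg_adj_matrix:
  assumes n: "n > 0" and D: "D \<subseteq> proper_divisors n"
  shows "char_poly (icg_adj_matrix n D)
       = (\<Prod>j\<leftarrow>[0..<n]. [:- of_real (icg_eigenvalue n D j), 1:])"
proof -
  define A where "A = icg_adj_matrix n D"
  define L where "L = mat n n (\<lambda>(i, j). if i = j then of_real (icg_eigenvalue n D j) else (0::complex))"
  define P where "P = mat n n (\<lambda>(a, j). zeta n (- (int j * int a)))"
  define Q where "Q = mat n n (\<lambda>(j, a). zeta n (int j * int a) / of_nat n)"
  have carrier [simp]: "A \<in> carrier_mat n n" "L \<in> carrier_mat n n"
      "P \<in> carrier_mat n n" "Q \<in> carrier_mat n n"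
    by (simp_all add: A_def icg_adj_matrix_def L_def P_def Q_def)
  have dims [simp]: "dim_row A = n" "dim_col A = n" "dim_row L = n" "dim_col L = n"
      "dim_row P = n" "dim_col P = n" "dim_row Q = n" "dim_col Q = n"
    using carrier by (meson carrier_matD)+
  have QP: "Q * P = 1\<^sub>m n"
  proof (rule eq_matI)
    fix i j assume "i < dim_row (1\<^sub>m n)" "j < dim_col (1\<^sub>m n)"
    then have ij: "i < n" "j < n" by simp_all
    have "(Q * P) $$ (i, j) = (\<Sum>a<n. zeta n ((int i - int j) * int a)) / of_nat n"
      using ij by (simp add: Q_def P_def scalar_prod_def zeta_add[symmetric] algebra_simps
          lessThan_atLeast0 sum_divide_distrib)
    also have "\<dots> = (if int n dvd int i - int j then 1 else 0)"
      using n by (simp add: sum_zeta)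
    also have "int n dvd int i - int j \<longleftrightarrow> i = j"
      using ij by (auto simp: mod_eq_dvd_iff[symmetric])
    finally show "(Q * P) $$ (i, j) = 1\<^sub>m n $$ (i, j)"
      using ij by simp
  qed auto
  then have PQ: "P * Q = 1\<^sub>m n"
    by (intro mat_mult_left_right_inverse[of Q n P]) auto
  have AP: "A * P = P * L"
  proof (rule eq_matI)
    fix a j assume "a < dim_row (P * L)" "j < dim_col (P * L)"
    then have aj: "a < n" "j < n" by simp_all
    have "(A * P) $$ (a, j)
        = (\<Sum>b<n. (if icg_adjacent n D a b then 1 else 0) * zeta n (- (int j * int b)))"
      using aj by (simp add: A_def icg_adj_matrix_def P_def scalar_prod_def lessThan_atLeast0)
    also have "\<dots> = of_real (icg_eigenvalue n D j) * zeta n (- (int j * int a))"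
      by (rule sum_icg_adj_matrix[OF D aj(1)])
    also have "\<dots> = (\<Sum>i<n. zeta n (- (int i * int a)) *
        (if i = j then of_real (icg_eigenvalue n D j) else 0))"
      using aj by (simp add: if_distrib[of "\<lambda>x. _ * x"] mult.commute cong: if_cong)
    also have "\<dots> = (P * L) $$ (a, j)"
      using aj by (simp add: P_def L_def scalar_prod_def lessThan_atLeast0)
    finally show "(A * P) $$ (a, j) = (P * L) $$ (a, j)" .
  qed auto
  have "A = A * (P * Q)" using PQ by simp
  also have "\<dots> = P * L * Q" by (simp add: assoc_mult_mat[symmetric, of _ n n _ n _ n] AP)
  finally have "similar_mat A L"
    using PQ QP by (intro similar_matI[of _ _ P Q n]) auto
  then have "char_poly A = char_poly L" by (rule char_poly_similar)
  also have "\<dots> = (\<Prod>x\<leftarrow>diag_mat L. [:- x, 1:])"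
    by (rule char_poly_upper_triangular[of L n]) (auto simp: L_def upper_triangular_def)
  also have "diag_mat L = map (\<lambda>j. of_real (icg_eigenvalue n D j)) [0..<n]"
    by (simp add: diag_mat_def L_def)
  finally show ?thesis by (simp add: A_def o_def)
qed

end

theory Submission
  imports Defs
begin

text \<open>
  The lower bound comes from a cancellation argument. Since \<open>n\<close> does not divide \<open>j\<close>, the
  Ramanujan values \<open>c(j,m)\<close> add up to \<open>0\<close> over all divisors \<open>m\<close> of \<open>n\<close>. Hence their negative
  part is half of \<open>A = \<Sum>\<^sub>m |c(j,m)|\<close>, and a sum over any set of divisors is at least \<open>-A/2\<close>
  (\<open>sum_subset_ge_minus_half_sum_abs\<close>).

  To bound \<open>A\<close>, pick a prime \<open>q\<close> that divides \<open>n\<close> exactly \<open>a\<close> times and \<open>j\<close> exactly \<open>b < a\<close>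
  times, and write \<open>n = q^a m\<close>. By multiplicativity \<open>A\<close> splits into a factor for \<open>q^a\<close>, which
  equals \<open>2 q^b\<close>, and a factor for \<open>m\<close>, which is at most \<open>\<Sum>\<^sub>d\<^sub>|\<^sub>m \<phi>(d) = m\<close>. This gives
  \<open>\<lambda>\<^sub>j \<ge> - q^b m\<close> (\<open>icg_eigenvalue_ge\<close>), and everything else is a choice of \<open>q\<close>.
  Let \<open>p\<close> be the least prime factor of \<open>n\<close>. If \<open>n/p\<close> does not divide \<open>j\<close>, some prime \<open>q\<close>
  divides \<open>j\<close> less often than \<open>n/p\<close>; then either \<open>q > p\<close>, or \<open>q = p\<close> and \<open>b \<le> a - 2\<close>, and in both
  cases \<open>q^b m < n/p\<close>, so that equality is impossible. If \<open>n/p\<close> divides \<open>j\<close>, then \<open>q = p\<close> with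
  \<open>b = a - 1\<close> gives exactly \<open>- n/p\<close>.

  In this last case all signs are known: \<open>c(j,n/d)\<close> is positive if \<open>p\<close> divides \<open>d\<close> and negative
  otherwise, and never \<open>0\<close>. So the minimum is attained by the set of all \<open>d\<close> prime to \<open>p\<close> and by
  no other set (\<open>icg_eigenvalue_eq_coprime_divisors_iff\<close>).
\<close>

section \<open>Sizes of Ramanujan sums\<close>

lemma ramanujan_eq_totient:
  assumes "m dvd j" "m > 0"
  shows "ramanujan j m = real (totient m)"
  using assms by (simp add: ramanujan_def Let_def gcd_nat.absorb1)

lemma abs_ramanujan_le_totient:
  assumes "m > 0"
  shows "\<bar>ramanujan j m\<bar> \<le> real (totient m)"
proof -
  define t where "t = m div gcd m j"
  have "t > 0"
    using assms by (simp add: t_def div_greater_zero_iff)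
  then have "real (totient m) / real (totient t) \<le> real (totient m)"
    by (simp add: divide_le_eq mult_le_cancel_left1 Suc_leI)
  moreover have "\<bar>moebius t\<bar> \<le> 1"
    by (simp add: moebius_def power_abs)
  then have "\<bar>real_of_int (moebius t)\<bar> \<le> 1"
    by linarith
  ultimately have "\<bar>real_of_int (moebius t)\<bar> * (real (totient m) / real (totient t))
      \<le> 1 * real (totient m)"
    by (intro mult_mono) auto
  then show ?thesis
    by (simp add: ramanujan_def Let_def abs_mult flip: t_def)
qed

text \<open>
  Consecutive partial sums of \<open>sum_ramanujan_prime_power\<close> differ by one Ramanujan value. This
  form separates the three cases: \<open>p ^ Suc a\<close> divides \<open>j\<close>, only \<open>p ^ a\<close> does, or neither does.
\<close>

lemma ramanujan_prime_power_Suc: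
  assumes "prime p"
  shows "ramanujan j (p ^ Suc a) =
    (if p ^ Suc a dvd j then real (p ^ Suc a) else 0) - (if p ^ a dvd j then real (p ^ a) else 0)"
  using sum_ramanujan_prime_power[OF assms, of j "Suc a"] sum_ramanujan_prime_power[OF assms, of j a]
  by (simp del: power_Suc)

text \<open>
  Let \<open>b\<close> be the exponent of \<open>p\<close> in \<open>j\<close>. The values at \<open>p ^ i\<close> with \<open>i \<le> b\<close> are totients, with
  sum \<open>p ^ b\<close>; the next value is \<open>- (p ^ b)\<close>, and all later ones vanish. Hence the factor \<open>2\<close> as
  soon as \<open>a > b\<close>.
\<close>

lemma sum_abs_ramanujan_prime_power:
  assumes p: "prime p" and j: "j > 0"
  shows "(\<Sum>i\<le>a. \<bar>ramanujan j (p ^ i)\<bar>) =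
    (if p ^ a dvd j then real (p ^ a) else 2 * real (p ^ multiplicity p j))"
proof (induction a)
  case 0
  then show ?case by (simp add: ramanujan_def)
next
  case (Suc a)
  have dvd: "p ^ i dvd j \<longleftrightarrow> i \<le> multiplicity p j" for i
    using p j by (intro power_dvd_iff_le_multiplicity) auto
  have "real (p ^ a) \<le> real (p ^ Suc a)"
    using p by (simp add: prime_gt_0_nat Suc_leI)
  note step = this Suc.IH ramanujan_prime_power_Suc[OF p, of j a]
  consider "Suc a \<le> multiplicity p j" | "a = multiplicity p j" | "a > multiplicity p j"
    by linarith
  then show ?case
    using step by cases (simp_all add: dvd del: power_Suc)
qed

section \<open>The lower bound attached to one prime\<close>

text \<open>
  Only the prime \<open>q\<close> is treated exactly; on the part prime to \<open>q\<close> the trivial bound by totients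
  already suffices, since they add up to \<open>m\<close>.
\<close>

lemma sum_abs_ramanujan_divisors_le:
  assumes q: "prime q" and nq: "\<not> q dvd m" and m: "m > 0" and j: "j > 0"
    and nd: "\<not> q ^ a dvd j"
  shows "(\<Sum>d | d dvd q ^ a * m. \<bar>ramanujan j d\<bar>) \<le> 2 * real (q ^ multiplicity q j * m)"
proof -
  have cop: "coprime (q ^ i) d" if "d dvd m" for i d
    using q nq that by (metis coprime_power_left_iff dvd_trans prime_imp_coprime)
  have "(\<Sum>d | d dvd q ^ a * m. \<bar>ramanujan j d\<bar>)
      = (\<Sum>(i, d)\<in>{..a} \<times> {d. d dvd m}. \<bar>ramanujan j (q ^ i * d)\<bar>)"
    by (subst sum.reindex_bij_betw[OF divisors_prime_power_mult[OF q nq m], symmetric])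
      (simp add: case_prod_unfold)
  also have "\<dots> = (\<Sum>(i, d)\<in>{..a} \<times> {d. d dvd m}. \<bar>ramanujan j (q ^ i)\<bar> * \<bar>ramanujan j d\<bar>)"
    using cop m q
    by (intro sum.cong refl)
      (auto simp: ramanujan_mult_coprime abs_mult prime_gt_0_nat dvd_pos_nat)
  also have "\<dots> = (\<Sum>i\<le>a. \<bar>ramanujan j (q ^ i)\<bar>) * (\<Sum>d | d dvd m. \<bar>ramanujan j d\<bar>)"
    by (simp add: sum_product sum.cartesian_product)
  also have "\<dots> = 2 * real (q ^ multiplicity q j) * (\<Sum>d | d dvd m. \<bar>ramanujan j d\<bar>)"
    using nd by (simp add: sum_abs_ramanujan_prime_power[OF q j])
  also have "(\<Sum>d | d dvd m. \<bar>ramanujan j d\<bar>) \<le> (\<Sum>d | d dvd m. real (totient d))"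
    using m by (intro sum_mono abs_ramanujan_le_totient) (auto simp: dvd_pos_nat)
  also have "\<dots> = real m"
    using totient_divisor_sum[of m] by (simp flip: of_nat_sum)
  finally show ?thesis
    by (simp add: mult.assoc mult_left_mono)
qed

text \<open>
  The sum over \<open>M\<close> is the negative of the sum over its complement, so twice the sum over \<open>M\<close> is a
  sum over \<open>B\<close> of the numbers \<open>f x\<close> with signs, hence at least \<open>- (\<Sum>x\<in>B. \<bar>f x\<bar>)\<close>.
\<close>

lemma sum_subset_ge_minus_half_sum_abs:
  fixes f :: "'a \<Rightarrow> real"
  assumes "finite B" "M \<subseteq> B" "sum f B = 0"
  shows "sum f M \<ge> - (\<Sum>x\<in>B. \<bar>f x\<bar>) / 2"
proof -
  have split: "sum g B = sum g (B - M) + sum g M" for g :: "'a \<Rightarrow> real"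
    using assms by (intro sum.subset_diff)
  have "sum f (B - M) \<le> (\<Sum>x\<in>B - M. \<bar>f x\<bar>)"
    by (intro sum_mono) simp
  moreover have "- sum f M \<le> (\<Sum>x\<in>M. \<bar>f x\<bar>)"
    by (subst sum_negf[symmetric], intro sum_mono) simp
  ultimately show ?thesis
    using split[of f] split[of "\<lambda>x. \<bar>f x\<bar>"] assms(3) by simp
qed

lemma inj_on_codivisor: "n > 0 \<Longrightarrow> inj_on ((div) n) {d. d dvd n}" for n :: nat
  by (rule inj_on_inverseI[of _ "(div) n"]) (auto elim: dvdE)

text \<open>
  The eigenvalue is a sum of Ramanujan values over the codivisors \<open>n div d\<close> of the elements of
  \<open>D\<close>. They form a subset of all divisors of \<open>n\<close>, over which the values cancel because
  \<open>n\<close> does not divide \<open>j\<close>.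
\<close>

lemma icg_eigenvalue_ge:
  assumes q: "prime q" and n: "n = q ^ a * m" and nq: "\<not> q dvd m" and m: "m > 0"
    and j: "j > 0" and nd: "\<not> q ^ a dvd j"
    and D: "D \<subseteq> proper_divisors n"
  shows "icg_eigenvalue n D j \<ge> - real (q ^ multiplicity q j * m)"
proof -
  have n0: "n > 0" using q n m by (simp add: prime_gt_0_nat)
  have Dn: "D \<subseteq> {d. d dvd n}"
    using D by (auto simp: proper_divisors_def)
  have "\<not> n dvd j"
    using nd n by (auto dest: dvd_mult_left)
  then have "(\<Sum>d | d dvd n. ramanujan j d) = 0"
    using sum_ramanujan_divisors[OF n0] by simp
  moreover have "(div) n ` D \<subseteq> {d. d dvd n}"
    using Dn by (auto elim!: dvdE dest!: subsetD)
  ultimately have "sum (ramanujan j) ((div) n ` D) \<ge> - (\<Sum>d | d dvd n. \<bar>ramanujan j d\<bar>) / 2"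
    using n0 by (intro sum_subset_ge_minus_half_sum_abs) auto
  moreover have "sum (ramanujan j) ((div) n ` D) = icg_eigenvalue n D j"
    using inj_on_subset[OF inj_on_codivisor[OF n0] Dn]
    by (simp add: icg_eigenvalue_def sum.reindex)
  ultimately show ?thesis
    using sum_abs_ramanujan_divisors_le[OF q nq m j nd] n by simp
qed

section \<open>The extremal case\<close>

context
  fixes n p a m j :: nat
  assumes p: "prime p" and n: "n = p ^ Suc a * m" and np: "\<not> p dvd m" and m: "m > 0"
    and dvd_j: "n div p dvd j" and n_ndvd_j: "\<not> n dvd j"
begin

text \<open>
  The codivisor \<open>n div d\<close> contains the full power \<open>p ^ Suc a\<close>, which just fails to divide \<open>j\<close> and
  contributes the factor \<open>- (p ^ a)\<close>; the remaining factor \<open>m div d\<close> divides \<open>j\<close>.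
\<close>

lemma ramanujan_codivisor_coprime:
  assumes "d dvd m"
  shows "ramanujan j (n div d) = - real (p ^ a * totient (m div d))"
proof -
  have d: "d > 0" using assms m dvd_pos_nat by blast
  have npj: "p ^ a * m dvd j"
    using dvd_j p by (simp add: n prime_gt_0_nat mult.assoc)
  have md: "m div d dvd m" "m div d > 0"
    using assms m by (auto elim: dvdE simp: div_greater_zero_iff dvd_imp_le)
  have cop: "coprime (p ^ i) x" if "x dvd m" for i x
    using p np that by (metis coprime_power_left_iff dvd_trans prime_imp_coprime)
  have mj: "m dvd j" "p ^ a dvd j"
    using npj by (auto dest: dvd_mult_left dvd_mult_right)
  have "\<not> p ^ Suc a dvd j"
    using n_ndvd_j mj cop[of m "Suc a"] unfolding n by (auto intro: divides_mult)
  then have "ramanujan j (p ^ Suc a) = - real (p ^ a)"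
    using mj by (simp add: ramanujan_prime_power_Suc[OF p] del: power_Suc)
  moreover have "ramanujan j (m div d) = real (totient (m div d))"
    using md mj by (intro ramanujan_eq_totient) (auto intro: dvd_trans)
  moreover have "n div d = p ^ Suc a * (m div d)"
    using assms by (simp add: n div_mult_swap)
  moreover have "ramanujan j (p ^ Suc a * (m div d)) = ramanujan j (p ^ Suc a) * ramanujan j (m div d)"
    using md cop p by (intro ramanujan_mult_coprime) (auto simp: prime_gt_0_nat)
  ultimately show ?thesis by simp
qed

text \<open>
  If \<open>p\<close> divides \<open>d\<close>, the codivisor divides \<open>n div p\<close> and therefore \<open>j\<close>, so its Ramanujan value is a
  totient.
\<close>

lemma ramanujan_codivisor_multiple:
  assumes "d dvd n" "p dvd d"
  shows "ramanujan j (n div d) > 0"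
proof -
  have n0: "n > 0" using p n m by (simp add: prime_gt_0_nat)
  obtain e where e: "n = d * e" using assms by blast
  obtain c where c: "d = p * c" using assms by blast
  have "e dvd n div p"
    using e c p by (simp add: prime_gt_0_nat mult.assoc)
  moreover have "n div d = e" "e > 0"
    using e n0 by auto
  ultimately show ?thesis
    using dvd_trans[OF _ dvd_j] by (simp add: ramanujan_eq_totient)
qed

lemma proper_divisors_coprime_eq: "{d \<in> proper_divisors n. \<not> p dvd d} = {d. d dvd m}"
proof (intro equalityI subsetI)
  fix d assume "d \<in> {d \<in> proper_divisors n. \<not> p dvd d}"
  then have d: "d dvd p ^ Suc a * m" "\<not> p dvd d"
    by (auto simp: proper_divisors_def n)
  then have "coprime d (p ^ Suc a)"
    using p by (metis coprime_commute coprime_power_right_iff prime_imp_coprime)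
  then show "d \<in> {d. d dvd m}"
    using d(1) coprime_dvd_mult_right_iff by blast
next
  fix d assume "d \<in> {d. d dvd m}"
  then have d: "d dvd m" by simp
  then have "d \<le> m" "d > 0" "\<not> p dvd d"
    using m np dvd_imp_le dvd_pos_nat dvd_trans by blast+
  moreover have "1 < p ^ Suc a"
    using p by (intro one_less_power prime_gt_1_nat) auto
  then have "1 * m < p ^ Suc a * m" using m by (intro mult_strict_right_mono)
  then have "m < n" by (simp only: n mult_1)
  moreover have "d dvd n" using d by (simp add: n)
  ultimately show "d \<in> {d \<in> proper_divisors n. \<not> p dvd d}"
    by (simp add: proper_divisors_def)
qed

lemma icg_eigenvalue_coprime_divisors:
  "icg_eigenvalue n {d \<in> proper_divisors n. \<not> p dvd d} j = - real (p ^ a * m)"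
proof -
  have "icg_eigenvalue n {d \<in> proper_divisors n. \<not> p dvd d} j
      = (\<Sum>d | d dvd m. - real (p ^ a * totient (m div d)))"
    unfolding proper_divisors_coprime_eq icg_eigenvalue_def
    by (intro sum.cong refl ramanujan_codivisor_coprime) simp
  also have "\<dots> = - real (p ^ a * (\<Sum>d | d dvd m. totient (m div d)))"
    by (simp add: sum_negf sum_distrib_left)
  also have "(\<Sum>d | d dvd m. totient (m div d)) = (\<Sum>d | d dvd m. totient d)"
    using m by (intro sum.reindex_bij_witness[of _ "(div) m" "(div) m"]) (auto elim: dvdE)
  finally show ?thesis by (simp add: totient_divisor_sum)
qed

text \<open>
  Passing from the set of all divisors prime to \<open>p\<close> to another set adds positive terms or removes
  negative ones. As no term vanishes, each such change strictly increases the eigenvalue.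
\<close>

lemma icg_eigenvalue_eq_coprime_divisors_iff:
  assumes D: "D \<subseteq> proper_divisors n"
  shows "icg_eigenvalue n D j = icg_eigenvalue n {d \<in> proper_divisors n. \<not> p dvd d} j
    \<longleftrightarrow> D = {d \<in> proper_divisors n. \<not> p dvd d}"
proof
  define E where "E = {d \<in> proper_divisors n. \<not> p dvd d}"
  define f where "f = (\<lambda>d. ramanujan j (n div d))"
  assume "icg_eigenvalue n D j = icg_eigenvalue n {d \<in> proper_divisors n. \<not> p dvd d} j"
  then have eq: "sum f D = sum f E"
    by (simp add: E_def f_def icg_eigenvalue_def)
  have "finite (proper_divisors n)"
    by (rule finite_subset[of _ "{..<n}"]) (auto simp: proper_divisors_def)
  then have fin: "finite D" "finite E"
    using D by (auto simp: E_def intro: finite_subset)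
  have pos: "f d > 0" if "d \<in> D - E" for d
    using that D ramanujan_codivisor_multiple by (auto simp: E_def f_def proper_divisors_def)
  have neg: "f d < 0" if "d \<in> E - D" for d
  proof -
    have "d dvd m" using that proper_divisors_coprime_eq by (auto simp: E_def)
    moreover from this have "m div d > 0"
      using m by (simp add: div_greater_zero_iff dvd_imp_le dvd_pos_nat)
    ultimately show ?thesis
      using p by (simp add: f_def ramanujan_codivisor_coprime prime_gt_0_nat)
  qed
  have "sum f (D - E) = sum f (E - D)"
    using eq fin sum.Int_Diff[of D f E] sum.Int_Diff[of E f D] by (simp add: Int_commute)
  moreover have "D - E \<noteq> {} \<Longrightarrow> sum f (D - E) > 0" "sum f (D - E) \<ge> 0"
    using pos fin by (auto intro: sum_pos sum_nonneg less_imp_le)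
  moreover have "E - D \<noteq> {} \<Longrightarrow> sum f (E - D) < 0" "sum f (E - D) \<le> 0"
    using neg fin sum_pos[of "E - D" "\<lambda>d. - f d"]
    by (auto simp: sum_negf intro: sum_nonpos less_imp_le)
  ultimately have "D - E = {}" "E - D = {}"
    by linarith+
  then show "D = {d \<in> proper_divisors n. \<not> p dvd d}"
    by (auto simp: E_def)
qed simp

end

section \<open>The least prime factor\<close>

lemma icg_eigenvalue_ge_least_prime:
  assumes p: "prime p" "p dvd n" and least: "\<And>q. prime q \<Longrightarrow> q dvd n \<Longrightarrow> p \<le> q"
    and j: "0 < j" "j < n" and D: "D \<subseteq> proper_divisors n"
  shows "icg_eigenvalue n D j \<ge> - (real n / real p) \<and>
    (icg_eigenvalue n D j = - (real n / real p) \<longleftrightarrow>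
      D = {d \<in> proper_divisors n. \<not> p dvd d} \<and> n div p dvd j)"
proof (cases "n div p dvd j")
  case True
  have n0: "n \<noteq> 0" and p0: "p > 0" using j p by (auto simp: prime_gt_0_nat)
  obtain m where m: "n = p ^ multiplicity p n * m" "\<not> p dvd m"
    using n0 p(1) by (metis multiplicity_decompose' not_prime_unit)
  have "multiplicity p n > 0"
    using p n0 by (simp add: prime_multiplicity_gt_zero_iff)
  then obtain a where a: "multiplicity p n = Suc a" using gr0_implies_Suc by blast
  have n: "n = p ^ Suc a * m" using m a by simp
  have m0: "m > 0" using n n0 by (cases m) auto
  have nj: "\<not> n dvd j" using j dvd_imp_le by auto
  note facts = p(1) n m(2) m0 True nj
  have val: "real n / real p = real (p ^ a * m)"
    using p0 by (simp add: n)
  have npj: "p ^ a * m dvd j"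
    using True p0 by (simp add: n mult.assoc)
  have mj: "m dvd j" using npj by (auto dest: dvd_mult_right)
  have paj: "\<not> p ^ Suc a dvd j"
  proof
    assume "p ^ Suc a dvd j"
    moreover have "coprime (p ^ Suc a) m"
      using p(1) m(2) by (metis coprime_power_left_iff prime_imp_coprime)
    ultimately show False using mj nj n by (auto intro: divides_mult)
  qed
  have "p ^ a dvd j" using npj by (auto dest: dvd_mult_left)
  then have "multiplicity p j = a"
    using paj by (rule multiplicity_eqI)
  then have "icg_eigenvalue n D j \<ge> - real (p ^ a * m)"
    using icg_eigenvalue_ge[OF p(1) n m(2) m0 j(1) paj D] by simp
  then show ?thesis
    using icg_eigenvalue_eq_coprime_divisors_iff[OF facts D] True
    by (simp add: val icg_eigenvalue_coprime_divisors[OF facts])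
next
  case False
  have n0: "n \<noteq> 0" and p0: "p > 0" using j p by (auto simp: prime_gt_0_nat)
  have np: "n = p * (n div p)" "n div p \<noteq> 0" using p n0 by auto
  obtain q where q: "prime q" "multiplicity q j < multiplicity q (n div p)"
    using False np(2) j(1) multiplicity_le_imp_dvd[of "n div p" j] by (metis not_le neq0_conv)
  define b where "b = multiplicity q j"
  define a where "a = multiplicity q n"
  obtain m where m: "n = q ^ a * m" "\<not> q dvd m"
    unfolding a_def using n0 q(1) by (metis multiplicity_decompose' not_prime_unit)
  have m0: "m > 0" using m n0 by (cases m) auto
  have qnp: "q dvd n div p"
    using q(2) by (metis not_dvd_imp_multiplicity_0 not_less0)
  then have "p \<le> q"
    using q(1) np(1) by (intro least) (auto intro: dvd_trans[of _ "n div p"])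
  have "a = multiplicity q p + multiplicity q (n div p)"
    unfolding a_def by (subst np(1))
      (use q(1) np(2) p0 in \<open>simp add: prime_elem_multiplicity_mult_distrib\<close>)
  then have ab: "b + multiplicity q p < a"
    using q(2) by (simp add: b_def)
  \<comment> \<open>Strictness has two sources: for \<open>q = p\<close> the exponent \<open>b\<close> is at least two short of \<open>a\<close>,
      and for \<open>q \<noteq> p\<close> the prime \<open>q\<close> is larger than \<open>p\<close>.\<close>
  have "p * q ^ b < q ^ a"
  proof (cases "q = p")
    case True
    then have "Suc b < a" using ab q(1) by (simp add: multiplicity_self)
    then have "q ^ Suc b < q ^ a" using q(1) by (intro power_strict_increasing prime_gt_1_nat)
    then show ?thesis using True by simp
  next
    case False
    then have "p * q ^ b < q ^ Suc b" using \<open>p \<le> q\<close> q(1) by (simp add: prime_gt_0_nat)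
    also have "\<dots> \<le> q ^ a" using ab q(1) by (intro power_increasing) (auto simp: prime_gt_0_nat Suc_leI)
    finally show ?thesis .
  qed
  then have "p * (q ^ b * m) < n" using m m0 by (simp add: mult.assoc[symmetric])
  then have "real p * real (q ^ b * m) < real n"
    by (simp only: of_nat_mult[symmetric] of_nat_less_iff)
  then have lt: "real (q ^ b * m) < real n / real p"
    using p0 by (simp only: less_divide_eq of_nat_0_less_iff if_True mult.commute)
  have "\<not> q ^ a dvd j"
    using ab q(1) j(1) power_dvd_iff_le_multiplicity[of j q a] prime_gt_1_nat[OF q(1)]
    by (simp add: b_def)
  then have "icg_eigenvalue n D j \<ge> - real (q ^ b * m)"
    unfolding b_def using icg_eigenvalue_ge[OF q(1) m(1,2) m0 j(1) _ D] by blast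
  then show ?thesis using lt False by linarith
qed

theorem theorem2:
  fixes n k j :: nat and p \<alpha> :: "nat \<Rightarrow> nat" and D :: "nat set"
  assumes "n \<ge> 2"
    and "n = (\<Prod>i=1..k. p i ^ \<alpha> i)"
    and "\<And>i. i \<in> {1..k} \<Longrightarrow> prime (p i)"
    and "strict_mono_on {1..k} p"
    and "\<And>i. i \<in> {1..k} \<Longrightarrow> \<alpha> i \<ge> 1"
    and "D \<subseteq> proper_divisors n"
    and "1 \<le> j" and "j \<le> n - 1"
  shows "icg_eigenvalue n D j \<ge> - (real n / real (p 1)) \<and>
    (icg_eigenvalue n D j = - (real n / real (p 1)) \<longleftrightarrow>
      D = {d \<in> proper_divisors n. \<not> p 1 dvd d} \<and> (n div p 1) dvd j)"
proof (rule icg_eigenvalue_ge_least_prime)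
  have k: "1 \<in> {1..k}"
    using assms(1,2) by (cases k) auto
  show "prime (p 1)" using assms(3) k by blast
  have "p 1 dvd p 1 ^ \<alpha> 1"
    using assms(5)[OF k] by (intro dvd_power) auto
  also have "\<dots> dvd n"
    unfolding assms(2) using k by (intro dvd_prodI) auto
  finally show "p 1 dvd n" .
  show "p 1 \<le> q" if q: "prime q" "q dvd n" for q
  proof -
    obtain i where i: "i \<in> {1..k}" "q dvd p i ^ \<alpha> i"
      using q prime_dvd_prod_iff[of "{1..k}" q "\<lambda>i. p i ^ \<alpha> i"] assms(2) by auto
    then have "q = p i"
      using q(1) assms(3) prime_dvd_power primes_dvd_imp_eq by blast
    moreover have "p 1 \<le> p i"
      using strict_mono_on_leD[OF assms(4) k i(1)] i(1) by simp
    ultimately show ?thesis by simp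
  qed
qed (use assms in auto)

end
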